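(* The product space $S_{\omega_1}\times S_{\omega_1}$ is not a $k_R$-space.
   Context: For an infinite cardinal $\kappa$, the sequential fan $S_\kappa$ is defined as follows. For each $\alpha\in\kappa$ let $T_\alpha$ be a (non-trivial) sequence converging to a point $x_\alpha\notin T_\alpha$. Then $S_\kappa=\{x\}\cup\bigcup_{\alpha\in\kappa}T_\alpha$ is the quotient space obtained from the topological sum $\bigoplus_{\alpha\in\kappa}(T_\alpha\cup\{x_\alpha\})$ by identifying all the points $x_\alpha$ to a single point $x$. A space $X$ is a $k_R$-space if $X$ is Tychonoff and every function $f:X\to\mathbb{R}$ whose restriction to each compact subset of $X$ is continuous is itself continuous. Products carry the product topology. *)

theory Defs
  imports "HOL-Analysis.Analysis"
begin

definition quotient_topology :: "'a topology \<Rightarrow> ('a \<Rightarrow> 'b) \<Rightarrow> 'b topology" where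
  "quotient_topology X q =
     topology (\<lambda>U. U \<subseteq> q ` topspace X \<and> openin X {x \<in> topspace X. q x \<in> U})"

lemma istopology_quotient_topology:
  "istopology (\<lambda>U. U \<subseteq> q ` topspace X \<and> openin X {x \<in> topspace X. q x \<in> U})"
proof -
  have 1: "{x \<in> topspace X. q x \<in> S \<inter> T} =
           {x \<in> topspace X. q x \<in> S} \<inter> {x \<in> topspace X. q x \<in> T}" for S T
    by blast
  have 2: "{x \<in> topspace X. q x \<in> \<Union>\<K>} = \<Union>((\<lambda>K. {x \<in> topspace X. q x \<in> K}) ` \<K>)" for \<K>
    by blast
  show ?thesis
    unfolding istopology_def
  proof (intro conjI allI impI)
    fix S T
    assume "S \<subseteq> q ` topspace X \<and> openin X {x \<in> topspace X. q x \<in> S}"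
      and "T \<subseteq> q ` topspace X \<and> openin X {x \<in> topspace X. q x \<in> T}"
    then show "S \<inter> T \<subseteq> q ` topspace X" "openin X {x \<in> topspace X. q x \<in> S \<inter> T}"
      by (blast, simp only: 1 openin_Int)
  next
    fix \<K>
    assume "\<forall>K\<in>\<K>. K \<subseteq> q ` topspace X \<and> openin X {x \<in> topspace X. q x \<in> K}"
    then show "\<Union>\<K> \<subseteq> q ` topspace X" "openin X {x \<in> topspace X. q x \<in> \<Union>\<K>}"
      by (blast, unfold 2, intro openin_Union, blast)
  qed
qed

lemma openin_quotient_topology:
  "openin (quotient_topology X q) U \<longleftrightarrow>
     U \<subseteq> q ` topspace X \<and> openin X {x \<in> topspace X. q x \<in> U}"
  by (simp add: quotient_topology_def istopology_quotient_topology)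

lemma topspace_quotient_topology [simp]: "topspace (quotient_topology X q) = q ` topspace X"
proof
  show "topspace (quotient_topology X q) \<subseteq> q ` topspace X"
    using openin_topspace[of "quotient_topology X q"] by (simp only: openin_quotient_topology)
  have "{x \<in> topspace X. q x \<in> q ` topspace X} = topspace X"
    by auto
  then have "openin (quotient_topology X q) (q ` topspace X)"
    by (simp add: openin_quotient_topology)
  then show "q ` topspace X \<subseteq> topspace (quotient_topology X q)"
    by (rule openin_subset)
qed

lemma quotient_map_quotient_topology: "quotient_map X (quotient_topology X q) q"
  by (simp add: quotient_map_def openin_quotient_topology)

text \<open>The space \<^term>\<open>C\<close> consists of the terms of a sequence and its limit \<^term>\<open>p\<close>, which is
  not a term. The Hausdorff condition forces every other point to be isolated, so that \<^term>\<open>C\<close>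
  is determined up to homeomorphism.\<close>

definition convergent_sequence_space :: "'a topology \<Rightarrow> 'a \<Rightarrow> bool" where
  "convergent_sequence_space C p \<longleftrightarrow>
     Hausdorff_space C \<and>
     (\<exists>s :: nat \<Rightarrow> 'a. inj s \<and> p \<notin> range s \<and> topspace C = insert p (range s) \<and>
        limitin C s p sequentially)"

text \<open>All base points \<^term>\<open>(\<alpha>, p \<alpha>)\<close> of the sum are sent to the single point
  \<^term>\<open>None\<close>; every other point is kept.\<close>

definition fan_collapse :: "('i \<Rightarrow> 'a) \<Rightarrow> 'i \<times> 'a \<Rightarrow> ('i \<times> 'a) option" where
  "fan_collapse p = (\<lambda>(\<alpha>, t). if t = p \<alpha> then None else Some (\<alpha>, t))"

text \<open>A cardinal is given, as in the library, by a cardinal order \<^term>\<open>\<kappa>\<close>; the ordinals below it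
  are the elements of \<^term>\<open>Field \<kappa>\<close>.\<close>

definition sequential_fan ::
  "'i rel \<Rightarrow> ('i \<Rightarrow> 'a topology) \<Rightarrow> ('i \<Rightarrow> 'a) \<Rightarrow> ('i \<times> 'a) option topology" where
  "sequential_fan \<kappa> C p = quotient_topology (sum_topology C (Field \<kappa>)) (fan_collapse p)"

definition omega_1 :: "nat set rel" where
  "omega_1 = cardSuc natLeq"

definition Tychonoff_space :: "'a topology \<Rightarrow> bool" where
  "Tychonoff_space X \<longleftrightarrow> completely_regular_space X \<and> Hausdorff_space X"

definition kR_space :: "'a topology \<Rightarrow> bool" where
  "kR_space X \<longleftrightarrow>
     Tychonoff_space X \<and>
     (\<forall>f :: 'a \<Rightarrow> real.
        (\<forall>K. compactin X K \<longrightarrow> continuous_map (subtopology X K) euclideanreal f) \<longrightarrow>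
        continuous_map X euclideanreal f)"

end

theory Submission
  imports Defs "HOL-Library.Countable_Set_Type"
begin

text \<open>Fix injections \<open>e \<beta>\<close> of the countable initial segments of \<open>\<omega>\<^sub>1\<close> into the naturals and let
  \<open>H\<close> be the set of all pairs of \<open>e \<beta> \<alpha>\<close>-th terms of the spines \<open>\<alpha>\<close> and \<open>\<beta>\<close>, for \<open>\<alpha> < \<beta>\<close>.
  Compact subsets of the fan meet only finitely many spines, so every compact subset of the square
  meets \<open>H\<close> in finitely many points; as these are isolated, the indicator of \<open>H\<close> is continuous on
  compact sets. A neighbourhood of the vertex contains, for uncountably many spines, all terms
  from some common index \<open>N\<close> on. One of these spines, \<open>\<beta>\<close>, has infinitely many of them below it,
  and so \<open>e \<beta> \<alpha> \<ge> N\<close> for one of the latter. Hence the vertex of the square is in the closure of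
  \<open>H\<close>, and the indicator is discontinuous there.\<close>

section \<open>Countability and uncountability in \<open>omega_1\<close>\<close>

lemma Card_order_omega_1: "Card_order omega_1"
  unfolding omega_1_def by (simp add: cardSuc_Card_order natLeq_Card_order)

lemma uncountable_Field_omega_1:
  includes cardinal_syntax
  shows "uncountable (Field omega_1)"
proof
  assume "countable (Field omega_1)"
  then have "|Field omega_1| \<le>o natLeq"
    by (simp add: countable_card_le_natLeq)
  then have "omega_1 \<le>o natLeq"
    using card_of_Field_ordIso[OF Card_order_omega_1] ordIso_symmetric ordIso_ordLeq_trans by blast
  then show False
    using cardSuc_greater[OF natLeq_Card_order] not_ordLess_ordLeq unfolding omega_1_def by blast
qed

text \<open>A proper initial segment of a cardinal has smaller cardinality, and anything smaller
  than the successor of aleph-zero is countable.\<close>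

lemma countable_underS_omega_1:
  includes cardinal_syntax
  assumes "\<beta> \<in> Field omega_1"
  shows "countable (underS omega_1 \<beta>)"
proof -
  have "|underS omega_1 \<beta>| <o omega_1"
    using card_of_underS[OF Card_order_omega_1 assms] .
  then have "|underS omega_1 \<beta>| \<le>o natLeq"
    unfolding omega_1_def using cardSuc_ordLeq_ordLess[OF natLeq_Card_order card_of_Card_order] by blast
  then show ?thesis
    by (simp add: countable_card_le_natLeq)
qed

text \<open>A countably infinite part \<open>B\<close> of \<open>A\<close>, together with the
  segments below its members, is still countable. Any \<open>\<beta>\<close> in \<open>A\<close>
  outside this set lies above all of \<open>B\<close>, because the order is total.\<close>

lemma omega_1_uncountable_infinite_below:
  assumes "A \<subseteq> Field omega_1" "uncountable A"
  shows "\<exists>\<beta>\<in>A. infinite (A \<inter> underS omega_1 \<beta>)"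
proof -
  have wo: "Well_order omega_1"
    using Card_order_omega_1 card_order_on_def by blast
  have "infinite A"
    using assms(2) countable_finite by blast
  then obtain B where B: "B \<subseteq> A" "countable B" "infinite B"
    using infinite_countable_subset'[of A] by blast
  have "countable (B \<union> (\<Union>b\<in>B. underS omega_1 b))"
    using B(1,2) assms(1) countable_underS_omega_1 by (simp add: subset_iff)
  then have "\<not> A \<subseteq> B \<union> (\<Union>b\<in>B. underS omega_1 b)"
    using assms(2) countable_subset by metis
  then obtain \<beta> where \<beta>: "\<beta> \<in> A" "\<beta> \<notin> B \<union> (\<Union>b\<in>B. underS omega_1 b)"
    unfolding subset_iff by blast
  have "B \<subseteq> underS omega_1 \<beta>"
  proof
    fix b
    assume b: "b \<in> B"
    have "total_on (Field omega_1) omega_1"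
      using wo by (simp add: well_order_on_def linear_order_on_def)
    then have "(b, \<beta>) \<in> omega_1 \<or> (\<beta>, b) \<in> omega_1"
      using b \<beta> B(1) assms(1) unfolding total_on_def by (metis UnI1 subsetD)
    then show "b \<in> underS omega_1 \<beta>"
      using b \<beta> unfolding underS_def by auto
  qed
  then have "infinite (A \<inter> underS omega_1 \<beta>)"
    using B(1,3) by (meson Int_greatest finite_subset)
  then show ?thesis
    using \<beta>(1) by blast
qed

text \<open>Pigeonhole principle: countably many countable fibres cannot cover \<open>A\<close>. It
  serves to make a threshold depending on the spine constant on uncountably many spines.\<close>

lemma uncountable_imp_uncountable_fibre:
  fixes g :: "'a \<Rightarrow> nat"
  assumes "uncountable A"
  shows "\<exists>N. uncountable {a \<in> A. g a = N}"
proof (rule ccontr)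
  assume "\<not> ?thesis"
  then have "countable (\<Union>N. {a \<in> A. g a = N})"
    by (intro countable_UN) auto
  moreover have "(\<Union>N. {a \<in> A. g a = N}) = A"
    by auto
  ultimately show False
    using assms by simp
qed

section \<open>Convergent sequences and the topology of the fan\<close>

lemma convergent_sequence_space_limit: "convergent_sequence_space C p \<Longrightarrow> p \<in> topspace C"
  unfolding convergent_sequence_space_def by auto

lemma convergent_sequence_space_t1: "convergent_sequence_space C p \<Longrightarrow> t1_space C"
  unfolding convergent_sequence_space_def by (auto intro: Hausdorff_imp_t1_space)

text \<open>Separate \<open>x\<close> from the limit by disjoint open sets. The one around the limit
  contains a tail of the sequence, so the one around \<open>x\<close> is finite; its other points
  form a closed set and can be removed.\<close>

lemma convergent_sequence_space_isolated:
  assumes "convergent_sequence_space C p" "x \<in> topspace C" "x \<noteq> p"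
  shows "openin C {x}"
proof -
  obtain s :: "nat \<Rightarrow> _" where s: "topspace C = insert p (range s)" "limitin C s p sequentially"
    and H: "Hausdorff_space C"
    using assms(1) unfolding convergent_sequence_space_def by auto
  obtain U V where UV: "openin C U" "openin C V" "x \<in> U" "p \<in> V" "disjnt U V"
    using H assms(2,3) convergent_sequence_space_limit[OF assms(1)]
    unfolding Hausdorff_space_def by blast
  obtain N where N: "\<And>n. n \<ge> N \<Longrightarrow> s n \<in> V"
    using s(2) UV unfolding limitin_sequentially by blast
  have "U \<subseteq> s ` {..<N}"
  proof
    fix u
    assume u: "u \<in> U"
    then have "u \<in> insert p (range s)"
      using openin_subset[OF UV(1)] s(1) by auto
    moreover have "u \<notin> V"
      using u UV(5) by (auto simp: disjnt_def)
    moreover have "n < N" if "s n \<notin> V" for n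
      using N[of n] that by (meson not_le)
    ultimately show "u \<in> s ` {..<N}"
      using UV(4) by blast
  qed
  then have "finite (U - {x})"
    using finite_subset by blast
  moreover have "U - {x} \<subseteq> topspace C"
    using openin_subset[OF UV(1)] by auto
  ultimately have "closedin C (U - {x})"
    using Hausdorff_imp_t1_space[OF H] t1_space_closedin_finite by blast
  then have "openin C (U - (U - {x}))"
    using UV(1) by blast
  moreover have "U - (U - {x}) = {x}"
    using UV(3) by auto
  ultimately show ?thesis
    by simp
qed

lemma topspace_sequential_fan:
  "topspace (sequential_fan \<kappa> C p) = fan_collapse p ` Sigma (Field \<kappa>) (topspace \<circ> C)"
  by (simp add: sequential_fan_def)

lemma openin_sequential_fan:
  "openin (sequential_fan \<kappa> C p) U \<longleftrightarrow>
     U \<subseteq> topspace (sequential_fan \<kappa> C p) \<and>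
     (\<forall>\<alpha>\<in>Field \<kappa>. openin (C \<alpha>) {t \<in> topspace (C \<alpha>). fan_collapse p (\<alpha>, t) \<in> U})"
proof -
  have "{t. (\<alpha>, t) \<in> {x \<in> Sigma (Field \<kappa>) (topspace \<circ> C). fan_collapse p x \<in> U}}
      = {t \<in> topspace (C \<alpha>). fan_collapse p (\<alpha>, t) \<in> U}" if "\<alpha> \<in> Field \<kappa>" for \<alpha>
    using that by auto
  then show ?thesis
    unfolding sequential_fan_def openin_quotient_topology openin_sum_topology by auto
qed

lemma Some_in_topspace_sequential_fan:
  "Some (\<alpha>, t) \<in> topspace (sequential_fan \<kappa> C p) \<longleftrightarrow>
     \<alpha> \<in> Field \<kappa> \<and> t \<in> topspace (C \<alpha>) \<and> t \<noteq> p \<alpha>"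
  unfolding topspace_sequential_fan
  by (force simp: fan_collapse_def split: if_splits)

text \<open>On each spine the complement of \<open>T\<close> omits only finitely many points, a
  closed set in a T1 space. The number of spines that \<open>T\<close> meets is not restricted, so
  infinite sets with one point on each of many spines are covered.\<close>

lemma closedin_sequential_fan:
  assumes t1: "\<And>\<alpha>. \<alpha> \<in> Field \<kappa> \<Longrightarrow> t1_space (C \<alpha>)"
    and T: "T \<subseteq> topspace (sequential_fan \<kappa> C p)" "None \<notin> T" "\<And>\<alpha>. finite {t. Some (\<alpha>, t) \<in> T}"
  shows "closedin (sequential_fan \<kappa> C p) T"
proof -
  let ?S = "sequential_fan \<kappa> C p"
  have "openin (C \<alpha>) {t \<in> topspace (C \<alpha>). fan_collapse p (\<alpha>, t) \<in> topspace ?S - T}"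
    if \<alpha>: "\<alpha> \<in> Field \<kappa>" for \<alpha>
  proof -
    have sub: "{t. Some (\<alpha>, t) \<in> T} \<subseteq> topspace (C \<alpha>)"
      using T(1) Some_in_topspace_sequential_fan by fast
    then have "closedin (C \<alpha>) {t. Some (\<alpha>, t) \<in> T}"
      using t1[OF \<alpha>] T(3) t1_space_closedin_finite by blast
    moreover have "{t \<in> topspace (C \<alpha>). fan_collapse p (\<alpha>, t) \<in> topspace ?S - T}
        = topspace (C \<alpha>) - {t. Some (\<alpha>, t) \<in> T}"
    proof -
      have "fan_collapse p (\<alpha>, t) \<in> topspace ?S" if "t \<in> topspace (C \<alpha>)" for t
        using \<alpha> that unfolding topspace_sequential_fan by auto
      moreover have "fan_collapse p (\<alpha>, t) \<in> T \<longleftrightarrow> Some (\<alpha>, t) \<in> T" for t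
        using T(1,2) Some_in_topspace_sequential_fan[of \<alpha> t \<kappa> C p]
        by (auto simp: fan_collapse_def)
      ultimately show ?thesis
        by auto
    qed
    ultimately show ?thesis
      by auto
  qed
  then show ?thesis
    unfolding closedin_def openin_sequential_fan using T(1) by auto
qed

lemma openin_sequential_fan_singleton:
  assumes "\<alpha> \<in> Field \<kappa>" "t \<noteq> p \<alpha>" "openin (C \<alpha>) {t}"
  shows "openin (sequential_fan \<kappa> C p) {Some (\<alpha>, t)}"
  unfolding openin_sequential_fan
proof (intro conjI ballI)
  show "{Some (\<alpha>, t)} \<subseteq> topspace (sequential_fan \<kappa> C p)"
    using assms openin_subset[OF assms(3)] by (simp add: Some_in_topspace_sequential_fan)
  fix \<beta>
  have "{u \<in> topspace (C \<beta>). fan_collapse p (\<beta>, u) \<in> {Some (\<alpha>, t)}}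
      = (if \<beta> = \<alpha> then {t} else {})"
    using assms(2) openin_subset[OF assms(3)] by (auto simp: fan_collapse_def split: if_splits)
  then show "openin (C \<beta>) {u \<in> topspace (C \<beta>). fan_collapse p (\<beta>, u) \<in> {Some (\<alpha>, t)}}"
    using assms(3) by simp
qed

text \<open>Otherwise one point from each of infinitely many spines gives an infinite subset
  \<open>D\<close> of \<open>L\<close>, which by compactness has an accumulation point in
  \<open>L\<close>. But \<open>D\<close> has at most one point on each spine and omits the vertex,
  so it cannot accumulate anywhere.\<close>

lemma compactin_sequential_fan_finite_spines:
  assumes t1: "\<And>\<alpha>. \<alpha> \<in> Field \<kappa> \<Longrightarrow> t1_space (C \<alpha>)"
    and L: "compactin (sequential_fan \<kappa> C p) L"
  shows "finite {\<alpha>. \<exists>t. Some (\<alpha>, t) \<in> L}"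
proof (rule ccontr)
  let ?S = "sequential_fan \<kappa> C p" and ?A = "{\<alpha>. \<exists>t. Some (\<alpha>, t) \<in> L}"
  assume inf: "infinite ?A"
  have "\<forall>\<alpha>\<in>?A. \<exists>t. Some (\<alpha>, t) \<in> L"
    by blast
  then obtain d where d: "\<forall>\<alpha>\<in>?A. Some (\<alpha>, d \<alpha>) \<in> L"
    by (rule bchoice[THEN exE])
  define D where "D = (\<lambda>\<alpha>. Some (\<alpha>, d \<alpha>)) ` ?A"
  have "inj_on (\<lambda>\<alpha>. Some (\<alpha>, d \<alpha>)) ?A"
    by (auto intro: inj_onI)
  then have "infinite D"
    unfolding D_def using inf finite_imageD by blast
  moreover have DL: "D \<subseteq> L"
    unfolding D_def using d by auto
  ultimately obtain x where x: "x \<in> L" "x \<in> ?S derived_set_of D"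
    using compactin_imp_Bolzano_Weierstrass[OF L] by blast
  \<comment> \<open>The point \<open>x\<close> may belong to \<open>D\<close>. With \<open>x\<close>
    removed, the complement is a neighbourhood of \<open>x\<close> free of other points of
    \<open>D\<close>.\<close>
  have "closedin ?S (D - {x})"
  proof (rule closedin_sequential_fan[OF t1])
    show "D - {x} \<subseteq> topspace ?S"
      using DL compactin_subset_topspace[OF L] by auto
    show "None \<notin> D - {x}"
      unfolding D_def by auto
    show "finite {t. Some (\<alpha>, t) \<in> D - {x}}" for \<alpha>
      by (rule finite_subset[of _ "{d \<alpha>}"]) (auto simp: D_def)
  qed
  then have "openin ?S (topspace ?S - (D - {x}))"
    by blast
  moreover have "x \<in> topspace ?S - (D - {x})"
    using x(1) compactin_subset_topspace[OF L] by auto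
  ultimately obtain y where "y \<noteq> x" "y \<in> D" "y \<in> topspace ?S - (D - {x})"
    using x(2) unfolding in_derived_set_of by meson
  then show False
    by simp
qed

section \<open>The indicator of \<open>H\<close> on the square\<close>

lemma continuous_map_indicator_clopen:
  assumes "openin X (topspace X \<inter> H)" "closedin X (topspace X \<inter> H)"
  shows "continuous_map X euclideanreal (indicator H)"
  unfolding continuous_map_def
proof (intro conjI allI impI)
  fix W :: "real set"
  have "{x \<in> topspace X. indicator H x \<in> W} =
      (if 1 \<in> W then topspace X \<inter> H else {}) \<union> (if 0 \<in> W then topspace X - topspace X \<inter> H else {})"
    by (auto simp: indicator_def)
  then show "openin X {x \<in> topspace X. indicator H x \<in> W}"
    using assms by (auto intro!: openin_Un openin_diff)
qed auto

theorem theorem3p3: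
  fixes C :: "nat set \<Rightarrow> 'a topology" and p :: "nat set \<Rightarrow> 'a"
  assumes "\<And>\<alpha>. \<alpha> \<in> Field omega_1 \<Longrightarrow> convergent_sequence_space (C \<alpha>) (p \<alpha>)"
  shows "\<not> kR_space (prod_topology (sequential_fan omega_1 C p) (sequential_fan omega_1 C p))"
proof
  let ?F = "Field omega_1" and ?S = "sequential_fan omega_1 C p"
  let ?X = "prod_topology ?S ?S"
  assume kR: "kR_space ?X"
  note t1 = convergent_sequence_space_t1[OF assms]
  have "\<forall>\<alpha>\<in>?F. \<exists>s :: nat \<Rightarrow> 'a. (\<forall>n. s n \<in> topspace (C \<alpha>) \<and> s n \<noteq> p \<alpha>)
      \<and> limitin (C \<alpha>) s (p \<alpha>) sequentially"
    using assms unfolding convergent_sequence_space_def by (metis insertI2 rangeI)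
  then obtain s :: "nat set \<Rightarrow> nat \<Rightarrow> 'a" where
    s: "\<And>\<alpha>. \<alpha> \<in> ?F \<Longrightarrow> (\<forall>n. s \<alpha> n \<in> topspace (C \<alpha>) \<and> s \<alpha> n \<noteq> p \<alpha>)
      \<and> limitin (C \<alpha>) (s \<alpha>) (p \<alpha>) sequentially"
    by metis
  have sS: "Some (\<alpha>, s \<alpha> n) \<in> topspace ?S" if "\<alpha> \<in> ?F" for \<alpha> n
    using s[OF that] that by (auto simp: Some_in_topspace_sequential_fan)
  define e where "e = (\<lambda>\<beta>. to_nat_on (underS omega_1 \<beta>))"
  have e: "inj_on (e \<beta>) (underS omega_1 \<beta>)" if "\<beta> \<in> ?F" for \<beta>
    unfolding e_def using countable_underS_omega_1[OF that] by (rule inj_on_to_nat_on)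
  \<comment> \<open>Both coordinates carry the same index \<open>e \<beta> \<alpha>\<close>, so one
    lower bound on it controls both.\<close>
  define h where "h = (\<lambda>(\<alpha>, \<beta>). (Some (\<alpha>, s \<alpha> (e \<beta> \<alpha>)), Some (\<beta>, s \<beta> (e \<beta> \<alpha>))))"
  define H where "H = h ` {(\<alpha>, \<beta>). \<alpha> \<in> underS omega_1 \<beta>}"
  have Field: "\<alpha> \<in> ?F" "\<beta> \<in> ?F" if "\<alpha> \<in> underS omega_1 \<beta>" for \<alpha> \<beta>
    using that unfolding underS_def by (auto intro: FieldI1 FieldI2)
  \<comment> \<open>Neither coordinate is the vertex, so each is an isolated point of the fan, and
    it is closed there as well.\<close>
  have H_isolated: "openin ?X {z}" "closedin ?X {z}" if zH: "z \<in> H" for z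
  proof -
    obtain \<alpha> \<beta> where ab: "\<alpha> \<in> underS omega_1 \<beta>" and z: "z = h (\<alpha>, \<beta>)"
      using zH unfolding H_def by auto
    have "{z} = {Some (\<alpha>, s \<alpha> (e \<beta> \<alpha>))} \<times> {Some (\<beta>, s \<beta> (e \<beta> \<alpha>))}"
      unfolding z h_def by simp
    moreover have "openin ?S {Some (\<gamma>, s \<gamma> n)}" "closedin ?S {Some (\<gamma>, s \<gamma> n)}"
      if "\<gamma> \<in> ?F" for \<gamma> n
    proof -
      have sn: "s \<gamma> n \<in> topspace (C \<gamma>)" "s \<gamma> n \<noteq> p \<gamma>"
        using s[OF that] by auto
      show "openin ?S {Some (\<gamma>, s \<gamma> n)}"
        using openin_sequential_fan_singleton[where C = C and p = p] that sn
          convergent_sequence_space_isolated[OF assms] by blast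
      show "closedin ?S {Some (\<gamma>, s \<gamma> n)}"
        by (rule closedin_sequential_fan[OF t1])
          (use sS[OF that] in \<open>auto intro: finite_subset[of _ "{s \<gamma> n}"]\<close>)
    qed
    ultimately show "openin ?X {z}" "closedin ?X {z}"
      using Field[OF ab] by (simp_all only: openin_prod_Times_iff closedin_prod_Times_iff) simp_all
  qed
  have "continuous_map (subtopology ?X K) euclideanreal (indicator H)" if K: "compactin ?X K" for K
  proof -
    define A where "A = {\<alpha>. \<exists>t. Some (\<alpha>, t) \<in> fst ` K}"
    define B where "B = {\<beta>. \<exists>t. Some (\<beta>, t) \<in> snd ` K}"
    have "compactin ?S (fst ` K)" "compactin ?S (snd ` K)"
      using image_compactin[OF K] continuous_map_fst continuous_map_snd by blast+
    then have fin: "finite A" "finite B"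
      unfolding A_def B_def by (simp_all add: compactin_sequential_fan_finite_spines[OF t1])
    \<comment> \<open>A point of \<open>H\<close> is determined by its two spines, and only finitely
      many pairs of spines are available in \<open>K\<close>.\<close>
    have "K \<inter> H \<subseteq> h ` (A \<times> B)"
    proof
      fix z
      assume z: "z \<in> K \<inter> H"
      then obtain \<alpha> \<beta> where ab: "z = h (\<alpha>, \<beta>)"
        unfolding H_def by auto
      then have "fst z = Some (\<alpha>, s \<alpha> (e \<beta> \<alpha>))" "snd z = Some (\<beta>, s \<beta> (e \<beta> \<alpha>))"
        unfolding h_def by auto
      then have "\<alpha> \<in> A" "\<beta> \<in> B"
        using z unfolding A_def B_def by (metis (mono_tags, lifting) IntD1 image_eqI mem_Collect_eq)+
      then show "z \<in> h ` (A \<times> B)"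
        using ab by blast
    qed
    then have "finite (K \<inter> H)"
      using fin finite_subset by blast
    then have "openin ?X (\<Union>z\<in>K \<inter> H. {z})" "closedin ?X (\<Union>z\<in>K \<inter> H. {z})"
      using H_isolated by (intro openin_Union closedin_Union; blast)+
    then have "openin ?X (K \<inter> H)" "closedin ?X (K \<inter> H)"
      by simp_all
    moreover have "topspace (subtopology ?X K) \<inter> H = K \<inter> H"
      using compactin_subset_topspace[OF K] by auto
    moreover have "K \<inter> (K \<inter> H) = K \<inter> H"
      by blast
    ultimately show ?thesis
      by (intro continuous_map_indicator_clopen)
        (metis inf_commute openin_subtopology, metis inf_commute closedin_subtopology)
  qed
  then have "continuous_map ?X euclideanreal (indicator H)"
    using kR unfolding kR_space_def by blast
  \<comment> \<open>On the square, the preimage of \<open>{..<1}\<close> is exactly the complement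
    of \<open>H\<close>. It is open and contains the vertex, hence also a box
    \<open>U \<times> V\<close> around it.\<close>
  then have W: "openin ?X {z \<in> topspace ?X. (indicator H z :: real) \<in> {..<1}}"
    by (rule openin_continuous_map_preimage) auto
  obtain \<gamma> where "\<gamma> \<in> ?F"
    using uncountable_Field_omega_1 by fastforce
  then have None: "None \<in> topspace ?S"
    using convergent_sequence_space_limit[OF assms]
    unfolding topspace_sequential_fan by (auto simp: fan_collapse_def image_iff)
  have "(None, None) \<notin> H"
    unfolding H_def h_def by auto
  then have "(None, None) \<in> {z \<in> topspace ?X. (indicator H z :: real) \<in> {..<1}}"
    using None by simp
  with W obtain U V where UV: "openin ?S U" "openin ?S V" "None \<in> U" "None \<in> V"
    "U \<times> V \<subseteq> {z \<in> topspace ?X. (indicator H z :: real) \<in> {..<1}}"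
    unfolding openin_prod_topology_alt by meson
  then have UVH: "U \<times> V \<inter> H = {}"
    by (auto simp: indicator_def split: if_splits)
  \<comment> \<open>Passing to \<open>U \<inter> V\<close> gives one neighbourhood of the vertex
    that works for both coordinates. Its trace on each spine contains a tail of the sequence, whose
    starting index becomes \<open>g \<alpha>\<close>.\<close>
  have "\<exists>N. \<forall>n\<ge>N. Some (\<alpha>, s \<alpha> n) \<in> U \<inter> V" if \<alpha>: "\<alpha> \<in> ?F" for \<alpha>
  proof -
    have "openin ?S (U \<inter> V)"
      using UV by blast
    then have "openin (C \<alpha>) {t \<in> topspace (C \<alpha>). fan_collapse p (\<alpha>, t) \<in> U \<inter> V}"
      using \<alpha> unfolding openin_sequential_fan by blast
    moreover have "p \<alpha> \<in> {t \<in> topspace (C \<alpha>). fan_collapse p (\<alpha>, t) \<in> U \<inter> V}"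
      using UV convergent_sequence_space_limit[OF assms[OF \<alpha>]] by (simp add: fan_collapse_def)
    ultimately obtain N where
      "\<forall>n\<ge>N. s \<alpha> n \<in> {t \<in> topspace (C \<alpha>). fan_collapse p (\<alpha>, t) \<in> U \<inter> V}"
      using s[OF \<alpha>] unfolding limitin_sequentially by meson
    moreover have "fan_collapse p (\<alpha>, s \<alpha> n) = Some (\<alpha>, s \<alpha> n)" for n
      using s[OF \<alpha>] unfolding fan_collapse_def by auto
    ultimately show ?thesis
      by auto
  qed
  then have "\<forall>\<alpha>\<in>?F. \<exists>N. \<forall>n\<ge>N. Some (\<alpha>, s \<alpha> n) \<in> U \<inter> V"
    by blast
  then obtain g where "\<forall>\<alpha>\<in>?F. \<forall>n\<ge>g \<alpha>. Some (\<alpha>, s \<alpha> n) \<in> U \<inter> V"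
    by (rule bchoice[THEN exE])
  then have g: "Some (\<alpha>, s \<alpha> n) \<in> U \<inter> V" if "\<alpha> \<in> ?F" "n \<ge> g \<alpha>" for \<alpha> n
    using that by blast
  obtain N where "uncountable {\<alpha> \<in> ?F. g \<alpha> = N}"
    using uncountable_imp_uncountable_fibre[OF uncountable_Field_omega_1] by blast
  then obtain \<beta> where \<beta>: "\<beta> \<in> ?F" "g \<beta> = N"
    and inf: "infinite ({\<alpha> \<in> ?F. g \<alpha> = N} \<inter> underS omega_1 \<beta>)"
    using omega_1_uncountable_infinite_below[of "{\<alpha> \<in> ?F. g \<alpha> = N}"] by blast
  \<comment> \<open>Injectivity of \<open>e \<beta>\<close> gives infinitely many indices, so they
    are unbounded in the naturals and one of them reaches \<open>N\<close>.\<close>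
  have "infinite (e \<beta> ` ({\<alpha> \<in> ?F. g \<alpha> = N} \<inter> underS omega_1 \<beta>))"
    using finite_imageD[OF _ inj_on_subset[OF e[OF \<beta>(1)] Int_lower2]] inf by blast
  then have "\<exists>n\<ge>N. n \<in> e \<beta> ` ({\<alpha> \<in> ?F. g \<alpha> = N} \<inter> underS omega_1 \<beta>)"
    by (simp only: infinite_nat_iff_unbounded_le)
  then obtain \<alpha> where \<alpha>: "\<alpha> \<in> ?F" "g \<alpha> = N" "\<alpha> \<in> underS omega_1 \<beta>" "e \<beta> \<alpha> \<ge> N"
    by blast
  \<comment> \<open>Both spines have threshold \<open>N\<close>, so the common index is large enough
    on each of them.\<close>
  then have "h (\<alpha>, \<beta>) \<in> U \<times> V"
    using g[of \<alpha> "e \<beta> \<alpha>"] g[of \<beta> "e \<beta> \<alpha>"] \<beta> unfolding h_def by auto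
  moreover have "h (\<alpha>, \<beta>) \<in> H"
    unfolding H_def using \<alpha>(3) by blast
  ultimately have "h (\<alpha>, \<beta>) \<in> U \<times> V \<inter> H"
    by (rule IntI)
  then show False
    by (simp only: UVH empty_iff)
qed

end
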